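(* Let $f(z)=z+\sum_{n=2}^\infty a_nz^n\in\mathcal{A}$ and let $f_2(z)=z+a_2z^2$ denote its second partial sum. (1) If $f\in\mathcal{K}$, then $f_2(\rho z)/\rho\in\mathcal{S}^*_{car}$ for $0<\rho\le1/3$. (2) If $f\in\mathcal{S}$ (or $f\in\mathcal{S}^*$, or $f\in\mathcal{C}$), then $f_2(\rho z)/\rho\in\mathcal{S}^*_{car}$ for $0<\rho\le1/6$.
   Context: $\mathbb{D}=\{z:|z|<1\}$; $\mathcal{A}$ is the class of analytic $f$ on $\mathbb{D}$ with $f(0)=0$, $f'(0)=1$. $\mathcal{S}$, $\mathcal{S}^*$, $\mathcal{K}$ are the subclasses of univalent, starlike and convex functions in $\mathcal{A}$; $\mathcal{C}$ is the class of close-to-convex functions in $\mathcal{A}$ (those $f$ for which there is a convex univalent $g$, not necessarily normalized, with $\operatorname{Re}(f'(z)/g'(z))>0$ on $\mathbb{D}$). $F\prec G$ means $F=G\circ w$ for an analytic $w:\mathbb{D}\to\mathbb{D}$ with $w(0)=0$. $\mathcal{S}^*_{car}$ is the class of $f\in\mathcal{A}$ with $zf'(z)/f(z)\prec 1+z+z^2/2$ in $\mathbb{D}$. *)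

theory Defs
  imports "HOL-Analysis.Analysis"
begin

abbreviation unit_disc :: "complex set" where
  "unit_disc \<equiv> ball 0 1"

definition class_A :: "(complex \<Rightarrow> complex) \<Rightarrow> bool" where
  "class_A f \<longleftrightarrow> f holomorphic_on unit_disc \<and> f 0 = 0 \<and> deriv f 0 = 1"

definition class_S :: "(complex \<Rightarrow> complex) \<Rightarrow> bool" where
  "class_S f \<longleftrightarrow> class_A f \<and> inj_on f unit_disc"

definition class_S_star :: "(complex \<Rightarrow> complex) \<Rightarrow> bool" where
  "class_S_star f \<longleftrightarrow> class_S f \<and>
     (\<forall>w \<in> f ` unit_disc. closed_segment 0 w \<subseteq> f ` unit_disc)"

definition class_K :: "(complex \<Rightarrow> complex) \<Rightarrow> bool" where
  "class_K f \<longleftrightarrow> class_S f \<and> convex (f ` unit_disc)"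

definition class_C :: "(complex \<Rightarrow> complex) \<Rightarrow> bool" where
  "class_C f \<longleftrightarrow> class_A f \<and>
     (\<exists>g. g holomorphic_on unit_disc \<and> inj_on g unit_disc \<and> convex (g ` unit_disc) \<and>
          (\<forall>z \<in> unit_disc. Re (deriv f z / deriv g z) > 0))"

definition subordinate :: "(complex \<Rightarrow> complex) \<Rightarrow> (complex \<Rightarrow> complex) \<Rightarrow> bool" where
  "subordinate F G \<longleftrightarrow> (\<exists>w. w holomorphic_on unit_disc \<and> w ` unit_disc \<subseteq> unit_disc \<and>
       w 0 = 0 \<and> (\<forall>z \<in> unit_disc. F z = G (w z)))"

text \<open>z f'(z)/f(z), with its removable value 1 at the origin.\<close>
definition zfprime_over_f :: "(complex \<Rightarrow> complex) \<Rightarrow> complex \<Rightarrow> complex" where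
  "zfprime_over_f f z = (if z = 0 then 1 else z * deriv f z / f z)"

definition class_S_star_car :: "(complex \<Rightarrow> complex) \<Rightarrow> bool" where
  "class_S_star_car f \<longleftrightarrow> class_A f \<and>
     subordinate (zfprime_over_f f) (\<lambda>z. 1 + z + z\<^sup>2 / 2)"

definition partial2 :: "(complex \<Rightarrow> complex) \<Rightarrow> complex \<Rightarrow> complex" where
  "partial2 f z = z + (deriv (deriv f) 0 / 2) * z\<^sup>2"

end

theory Submission
  imports Defs "HOL-Complex_Analysis.Complex_Analysis"
begin

text \<open>
  Everything reduces to bounds on the second coefficient. Put \<open>b = a\<^sub>2 \<rho>\<close>; for
  \<open>F(z) = z + b z\<^sup>2\<close> the equation \<open>z F'(z) / F(z) = 1 + w + w\<^sup>2/2\<close> is solved by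
  \<open>1 + w = sqrt ((1 + 3 b z) / (1 + b z))\<close>. If \<open>\<bar>b\<bar> \<le> 1/3\<close>, the radicand lies in the disc with
  diameter \<open>(0, 3/2)\<close>, whose square root lies in \<open>\<bar>s - 1\<bar> < 1\<close>.

  For convex \<open>f\<close>, \<open>(f(z) + f(-z))/2\<close> stays in the image, so \<open>f\<^sup>-\<^sup>1((f(z) + f(-z))/2)\<close> is a
  self-map of the disc, and Cauchy's estimate for its second derivative gives \<open>\<bar>a\<^sub>2\<bar> \<le> 1\<close>. For
  close-to-convex \<open>f\<close> write \<open>f' = g' p\<close> with \<open>Re p > 0\<close> and combine this with Caratheodory's
  \<open>\<bar>p'(0)\<bar> \<le> 2 Re p(0)\<close>.

  For univalent \<open>f\<close> the bound \<open>\<bar>a\<^sub>2\<bar> \<le> 2\<close> comes from the area theorem for the odd function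
  \<open>h(z) = f(z\<^sup>2)\<^sup>-\<^sup>1\<^sup>/\<^sup>2 = 1/z + b z + \<dots>\<close>. On the circle of radius \<open>r\<close>, \<open>h\<close> is close to an
  ellipse, which the real-linear map \<open>w - b r\<^sup>2 cnj w\<close> turns into a circle of radius about \<open>1/r\<close>.
  By univalence the annulus \<open>r < \<bar>z\<bar> < 1\<close> is mapped inside; its area, computed in the
  coordinate \<open>log z\<close>, is at least \<open>\<pi> (1/r\<^sup>2 - 1 + \<bar>b\<bar>\<^sup>2) + o(1)\<close>, so letting \<open>r\<close> tend to \<open>0\<close>
  yields \<open>\<bar>b\<bar> \<le> 1\<close>.
\<close>

section \<open>Convex and close-to-convex functions\<close>

text \<open>Cauchy's inequality holds on every circle of radius \<open>r < 1\<close>; then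
  \<open>r\<close> tends to 1, since \<open>f\<close> is controlled only on the open disc.\<close>

lemma higher_deriv_bound_unit_disc:
  assumes holf: "f holomorphic_on ball 0 1"
    and bound: "\<And>z. z \<in> ball 0 1 \<Longrightarrow> norm (f z) \<le> 1"
  shows "norm ((deriv ^^ n) f 0) \<le> fact n"
proof (rule tendsto_lowerbound)
  show "((\<lambda>r::real. fact n * 1 / r ^ n) \<longlongrightarrow> fact n) (at_left 1)"
    by (rule tendsto_eq_intros refl | simp)+
  show "\<forall>\<^sub>F r in at_left 1. norm ((deriv ^^ n) f 0) \<le> fact n * 1 / r ^ n"
    using eventually_at_left_real[of 0 "1::real", OF zero_less_one]
  proof eventually_elim
    case (elim r)
    then have sub: "cball (0::complex) r \<subseteq> ball 0 1" by auto
    show ?case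
    proof (rule Cauchy_inequality)
      show "f holomorphic_on ball 0 r"
        using holf sub by (meson holomorphic_on_subset ball_subset_cball order_trans)
      show "continuous_on (cball 0 r) f"
        using holf sub by (meson holomorphic_on_imp_continuous_on continuous_on_subset)
    qed (use elim bound in \<open>auto simp: dist_norm\<close>)
  qed
qed (simp add: trivial_limit_at_left_real)

lemma has_deriv_unit_disc:
  assumes "f holomorphic_on ball 0 1" "norm z < 1"
  shows "(f has_field_derivative deriv f z) (at z)"
  using assms by (auto intro!: holomorphic_derivI[of f "ball 0 1"])

text \<open>With \<open>g\<close> inverse to \<open>f\<close> and \<open>h\<close> the
  symmetrization of \<open>f\<close>, the map \<open>\<phi>\<close>, that is \<open>g\<close> after
  \<open>h\<close>, is an even self-map of the disc with second derivative f''(0) / f'(0) at 0. No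
  normalization is imposed, so that the bound also applies to the comparison function in
  \<open>class_C\<close>.\<close>

lemma convex_second_coeff_bound:
  assumes holf: "f holomorphic_on ball 0 1" and inj: "inj_on f (ball 0 1)"
    and conv: "convex (f ` ball 0 1)"
  shows "norm (deriv (deriv f) 0) \<le> 2 * norm (deriv f 0)"
proof -
  obtain g where holg: "g holomorphic_on (f ` ball 0 1)"
    and dg: "\<And>z. z \<in> ball 0 1 \<Longrightarrow> deriv f z * deriv g (f z) = 1"
    and gf: "\<And>z. z \<in> ball 0 1 \<Longrightarrow> g (f z) = z"
    using holomorphic_has_inverse[OF holf open_ball inj] by blast
  have opn: "open (f ` ball 0 1)"
    using open_mapping_thm3[OF holf open_ball inj] .
  define h where "h z = (f z + f (-z)) / 2" for z
  have h_in: "h z \<in> f ` ball 0 1" if "norm z < 1" for z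
  proof -
    have "(1/2) *\<^sub>R f z + (1/2) *\<^sub>R f (-z) \<in> f ` ball 0 1"
      by (rule convexD[OF conv]) (use that in auto)
    then show ?thesis by (simp add: h_def scaleR_conv_of_real field_simps)
  qed
  have dh: "(h has_field_derivative (deriv f z - deriv f (-z)) / 2) (at z)" if "norm z < 1" for z
  proof -
    have "((\<lambda>z. f (-z)) has_field_derivative deriv f (-z) * (-1)) (at z)"
      by (rule DERIV_chain2[OF has_deriv_unit_disc[OF holf]]) (use that in \<open>auto intro!: derivative_eq_intros\<close>)
    then show ?thesis
      unfolding h_def by (auto intro!: derivative_eq_intros has_deriv_unit_disc[OF holf] that)
  qed
  define \<phi> where "\<phi> z = g (h z)" for z
  have d\<phi>: "(\<phi> has_field_derivative deriv g (h z) * ((deriv f z - deriv f (-z)) / 2)) (at z)"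
    if "norm z < 1" for z
    unfolding \<phi>_def
    by (rule DERIV_chain2[OF holomorphic_derivI[OF holg opn] dh]) (use h_in that in auto)
  have hol\<phi>: "\<phi> holomorphic_on ball 0 1"
    by (rule holomorphic_onI) (use d\<phi> field_differentiable_at_within field_differentiable_def in fastforce)
  have "norm ((deriv ^^ 2) \<phi> 0) \<le> fact 2"
  proof (rule higher_deriv_bound_unit_disc[OF hol\<phi>])
    fix z :: complex assume "z \<in> ball 0 1"
    then obtain w where "w \<in> ball 0 1" "h z = f w" using h_in[of z] by auto
    then show "norm (\<phi> z) \<le> 1" using gf[of w] by (simp add: \<phi>_def)
  qed
  then have bound: "norm (deriv (deriv \<phi>) 0) \<le> 2" by (simp add: numeral_2_eq_2)
  have hol': "deriv f holomorphic_on ball 0 1" by (simp add: holf holomorphic_deriv)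
  have "((\<lambda>z. deriv f (-z)) has_field_derivative deriv (deriv f) (-0) * (-1)) (at 0)"
    by (rule DERIV_chain2[OF has_deriv_unit_disc[OF hol']]) (auto intro!: derivative_eq_intros)
  then have 1: "((\<lambda>z. (deriv f z - deriv f (-z)) / 2) has_field_derivative deriv (deriv f) 0) (at 0)"
    by (auto intro!: derivative_eq_intros has_deriv_unit_disc[OF hol'])
  \<comment> \<open>As \<open>h\<close> is even, its derivative at 0 vanishes, so only the second
    derivative of \<open>h\<close> survives in that of \<open>\<phi>\<close>.\<close>
  have "((\<lambda>z. deriv g (h z)) has_field_derivative deriv (deriv g) (h 0) * 0) (at 0)"
    by (rule DERIV_chain2[OF holomorphic_derivI[OF holomorphic_deriv[OF holg opn] opn]])
      (use h_in[of 0] dh[of 0] in auto)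
  from DERIV_mult[OF this 1] have
    2: "((\<lambda>z. deriv g (h z) * ((deriv f z - deriv f (-z)) / 2)) has_field_derivative
      deriv (deriv f) 0 * deriv g (h 0)) (at 0)"
    by simp
  have ev: "\<forall>\<^sub>F z in nhds 0. deriv g (h z) * ((deriv f z - deriv f (-z)) / 2) = deriv \<phi> z"
    by (rule eventually_mono[OF eventually_nhds_in_open[of "ball 0 1"]]) (simp_all only: mem_ball_0 DERIV_imp_deriv[OF d\<phi>] open_ball norm_zero zero_less_one)
  have "(deriv \<phi> has_field_derivative deriv (deriv f) 0 * deriv g (h 0)) (at 0)"
    using DERIV_cong_ev[OF refl ev refl] 2 by simp
  then have "deriv (deriv \<phi>) 0 = deriv (deriv f) 0 * deriv g (f 0)"
    by (simp add: DERIV_imp_deriv h_def)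
  moreover have "deriv g (f 0) * deriv f 0 = 1" using dg[of 0] by (simp add: mult.commute)
  ultimately have "deriv (deriv f) 0 = deriv (deriv \<phi>) 0 * deriv f 0"
    by (simp only: mult.assoc mult_1_right)
  with bound show ?thesis by (simp add: norm_mult mult_right_mono)
qed

text \<open>The Moebius map in \<open>q\<close> sends the right half-plane to the unit disc and
  \<open>p 0\<close> to 0. Cauchy's estimate then bounds q'(0) = p'(0) / (2 Re p(0)) by 1.\<close>

lemma Caratheodory_first_coeff_bound:
  assumes holp: "p holomorphic_on ball 0 1"
    and pos: "\<And>z. z \<in> ball 0 1 \<Longrightarrow> Re (p z) > 0"
  shows "norm (deriv p 0) \<le> 2 * Re (p 0)"
proof -
  define q where "q z = (p z - p 0) / (p z + cnj (p 0))" for z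
  have p0: "Re (p 0) > 0" using pos[of 0] by simp
  have nz: "p z + cnj (p 0) \<noteq> 0" if "norm z < 1" for z
  proof -
    have "Re (p z + cnj (p 0)) > 0" using p0 pos[of z] that by simp
    then show ?thesis by (metis less_irrefl zero_complex.sel(1))
  qed
  have holq: "q holomorphic_on ball 0 1"
    unfolding q_def by (intro holomorphic_intros holp) (use nz in auto)
  have "norm ((deriv ^^ 1) q 0) \<le> fact 1"
  proof (rule higher_deriv_bound_unit_disc[OF holq])
    fix z :: complex assume z: "z \<in> ball 0 1"
    \<comment> \<open>The two sides differ by \<open>4 * Re (p z) * Re (p 0)\<close>.\<close>
    have "(norm (p z - p 0))\<^sup>2 \<le> (norm (p z + cnj (p 0)))\<^sup>2"
      using mult_nonneg_nonneg[of "Re (p z)" "Re (p 0)"] p0 pos[OF z]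
      unfolding cmod_power2 by (simp add: power2_eq_square algebra_simps)
    then have "norm (p z - p 0) \<le> norm (p z + cnj (p 0))"
      by (rule power2_le_imp_le) simp
    then show "norm (q z) \<le> 1"
      using nz[of z] z by (simp add: q_def norm_divide)
  qed
  moreover have "(q has_field_derivative deriv p 0 / (p 0 + cnj (p 0))) (at 0)"
    unfolding q_def
    by (rule derivative_eq_intros has_deriv_unit_disc[OF holp] | use nz[of 0] in simp)+
  then have "deriv q 0 = deriv p 0 / (2 * Re (p 0))"
    by (simp add: DERIV_imp_deriv complex_add_cnj)
  ultimately show ?thesis
    using p0 by (simp add: norm_divide norm_mult)
qed

text \<open>Differentiating f' = p g' gives f''(0) = p'(0) g'(0) + g''(0) p(0). Each summand is at
  most 2 |p(0) g'(0)| = 2 |f'(0)| = 2.\<close>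

lemma close_to_convex_second_coeff_bound:
  assumes "class_C f"
  shows "norm (deriv (deriv f) 0) \<le> 4"
proof -
  obtain g where holg: "g holomorphic_on ball 0 1" and injg: "inj_on g (ball 0 1)"
    and conv: "convex (g ` ball 0 1)"
    and pos: "\<And>z. z \<in> ball 0 1 \<Longrightarrow> Re (deriv f z / deriv g z) > 0"
    and holf: "f holomorphic_on ball 0 1" and f1: "deriv f 0 = 1"
    using assms unfolding class_C_def class_A_def by blast
  define p where "p z = deriv f z / deriv g z" for z
  have nz: "deriv g z \<noteq> 0" if "norm z < 1" for z
    using pos[of z] that by auto
  have hol': "deriv f holomorphic_on ball 0 1" "deriv g holomorphic_on ball 0 1"
    by (simp_all add: holf holg holomorphic_deriv)
  have holp: "p holomorphic_on ball 0 1"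
    unfolding p_def by (intro holomorphic_intros hol') (use nz in auto)
  have p0: "p 0 * deriv g 0 = 1" using nz[of 0] f1 by (simp add: p_def)
  then have p0n: "norm (p 0) * norm (deriv g 0) = 1" by (metis norm_mult norm_one)
  have "((\<lambda>z. p z * deriv g z) has_field_derivative deriv p 0 * deriv g 0 + deriv (deriv g) 0 * p 0) (at 0)"
    by (intro DERIV_mult has_deriv_unit_disc holp hol') auto
  moreover have ev: "\<forall>\<^sub>F z in nhds 0. p z * deriv g z = deriv f z"
    using eventually_nhds_in_open[of "ball (0::complex) 1" 0]
    by (auto elim!: eventually_mono simp: p_def nz)
  ultimately have "(deriv f has_field_derivative deriv p 0 * deriv g 0 + deriv (deriv g) 0 * p 0) (at 0)"
    by (simp only: DERIV_cong_ev[OF refl ev refl])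
  then have eq: "deriv (deriv f) 0 = deriv p 0 * deriv g 0 + deriv (deriv g) 0 * p 0"
    by (rule DERIV_imp_deriv)
  have "norm (deriv p 0) \<le> 2 * Re (p 0)"
    by (rule Caratheodory_first_coeff_bound[OF holp]) (use pos in \<open>simp add: p_def\<close>)
  also have "\<dots> \<le> 2 * norm (p 0)" by (simp add: complex_Re_le_cmod)
  finally have "norm (deriv p 0) * norm (deriv g 0) \<le> 2 * norm (p 0) * norm (deriv g 0)"
    by (rule mult_right_mono) simp
  moreover have "norm (deriv (deriv g) 0) * norm (p 0) \<le> 2 * norm (deriv g 0) * norm (p 0)"
    using convex_second_coeff_bound[OF holg injg conv] by (rule mult_right_mono) simp
  moreover have "norm (deriv (deriv f) 0) \<le> norm (deriv p 0) * norm (deriv g 0) + norm (deriv (deriv g) 0) * norm (p 0)"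
    unfolding eq norm_mult[symmetric] by (rule norm_triangle_ineq)
  moreover have "2 * norm (p 0) * norm (deriv g 0) = 2" "2 * norm (deriv g 0) * norm (p 0) = 2"
    using p0n by (simp_all only: mult.assoc mult.commute[of "norm (deriv g 0)"] mult_1_right)
  ultimately show ?thesis by linarith
qed

section \<open>The area theorem for odd functions\<close>

text \<open>
  The region \<open>{v. norm (L (1 / v)) > M}\<close> together with \<open>0\<close> is star-shaped about \<open>0 = F 0\<close> and misses
  the image of the circle of radius \<open>r\<close>, so it lies in the image of the disc of radius \<open>r\<close>.
\<close>

lemma reciprocal_image_bound:
  fixes L :: "complex \<Rightarrow> complex"
  assumes holF: "F holomorphic_on ball 0 1" and inj: "inj_on F (ball 0 1)" and F0: "F 0 = 0"
    and r: "0 < r" "r < 1" and L: "linear L"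
    and bound: "\<And>z. norm z = r \<Longrightarrow> norm (L (1 / F z)) \<le> M"
    and z: "r \<le> norm z" "norm z < 1"
  shows "norm (L (1 / F z)) \<le> M"
proof -
  let ?B = "F ` ball 0 r"
  have sub: "cball (0::complex) r \<subseteq> ball 0 1" "ball (0::complex) r \<subseteq> ball 0 1" using r by auto
  have "open ?B"
    using open_mapping_thm3[of F "ball 0 r"] holF inj sub
    by (meson holomorphic_on_subset inj_on_subset open_ball)
  moreover have "closure ?B \<subseteq> F ` cball 0 r"
  proof (rule closure_minimal)
    have "compact (F ` cball 0 r)"
      using holF sub
      by (meson compact_cball compact_continuous_image continuous_on_subset holomorphic_on_imp_continuous_on)
    then show "closed (F ` cball 0 r)" by (rule compact_imp_closed)
  qed auto
  ultimately have front: "frontier ?B \<subseteq> F ` sphere 0 r"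
    unfolding frontier_def by (force simp: interior_open)
  have out: "F z \<notin> ?B"
  proof
    assume "F z \<in> ?B"
    then obtain y where "norm y < r" "F z = F y" by auto
    with inj z r show False by (auto dest!: inj_onD)
  qed
  have "closed_segment 0 (F z) \<inter> frontier ?B \<noteq> {}"
  proof (rule connected_Int_frontier)
    have "0 \<in> ?B" using F0 r by force
    then show "closed_segment 0 (F z) \<inter> ?B \<noteq> {}" by auto
    show "closed_segment 0 (F z) - ?B \<noteq> {}" using out by auto
  qed simp
  then obtain y where y: "norm y = r" "F y \<in> closed_segment 0 (F z)" using front by force
  then obtain t where t: "0 \<le> t" "t \<le> 1" "F y = t *\<^sub>R F z"
    by (auto simp: in_segment)
  have "F y \<noteq> F 0"
    using inj_onD[OF inj, of y 0] y r by auto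
  with t F0 have tpos: "t > 0" by (cases "t = 0") auto
  \<comment> \<open>Moving from \<open>F y\<close> outward to \<open>F z\<close> shrinks the
    reciprocal by the real factor \<open>t\<close>, which passes through the real-linear
    \<open>L\<close>.\<close>
  then have "1 / F z = t *\<^sub>R (1 / F y)"
    using t(3) by (simp add: scaleR_conv_of_real)
  then have "norm (L (1 / F z)) = t * norm (L (1 / F y))"
    using tpos by (simp add: linear_scale[OF L] del: scaleR_conv_of_real)
  also have "\<dots> \<le> 1 * M"
    using bound[OF y(1)] t tpos by (intro mult_mono) auto
  finally show ?thesis by simp
qed

section \<open>Integration over circles and rectangles\<close>

text \<open>Cauchy's integral formula at the centre, with dz / z = i d\<theta> on the
  circle.\<close>

lemma mean_value_circle:
  fixes N :: "complex \<Rightarrow> complex"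
  assumes holN: "N holomorphic_on ball 0 1" and s: "0 < s" "s < 1"
  shows "((\<lambda>\<theta>. N (of_real s * cis \<theta>)) has_integral 2 * pi * N 0) {0..2*pi}"
proof -
  have sub: "cball (0::complex) s \<subseteq> ball 0 1" "ball (0::complex) s \<subseteq> ball 0 1" using s by auto
  have "((\<lambda>u. N u / (u - 0)) has_contour_integral 2 * of_real pi * \<i> * N 0) (circlepath 0 s)"
    using holN sub s
    by (intro Cauchy_integral_circlepath)
      (auto intro: holomorphic_on_imp_continuous_on continuous_on_subset holomorphic_on_subset)
  then have "((\<lambda>t. N (of_real s * cis t) / (of_real s * cis t) * of_real s * \<i> * cis t)
      has_integral 2 * of_real pi * \<i> * N 0) {0..2*pi}"
    unfolding circlepath_def by (subst (asm) has_contour_integral_part_circlepath_iff) simp_all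
  from has_integral_mult_right[OF this, of "-\<i>"]
  show ?thesis using s by (simp add: field_simps)
qed

text \<open>Connects two models of the plane: the Jacobian formula is applied in
  \<open>real^2\<close>, while iterated integrals live on \<open>real \<times> real\<close>. The
  coordinate maps \<open>?g\<close> and \<open>?h\<close> take boxes to boxes and preserve
  content.\<close>

lemma integral_cbox_real2:
  fixes f :: "real \<times> real \<Rightarrow> real"
  assumes "continuous_on (cbox (a, c) (b, d)) f"
  shows "integral (cbox (vector [a, c]) (vector [b, d] :: real^2)) (\<lambda>v. f (v $ 1, v $ 2))
    = integral {a..b} (\<lambda>x. integral {c..d} (\<lambda>y. f (x, y)))"
proof -
  let ?g = "\<lambda>v :: real^2. (v $ 1, v $ 2)" and ?h = "\<lambda>(x, y). vector [x, y] :: real^2"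
  have gbox: "?g ` cbox u v = cbox (?g u) (?g v)" for u v
  proof (rule set_eqI)
    fix p :: "real \<times> real"
    show "p \<in> ?g ` cbox u v \<longleftrightarrow> p \<in> cbox (?g u) (?g v)"
    proof
      assume "p \<in> ?g ` cbox u v"
      then show "p \<in> cbox (?g u) (?g v)"
        by (auto simp: mem_box_cart cbox_Pair_eq)
    next
      assume p: "p \<in> cbox (?g u) (?g v)"
      show "p \<in> ?g ` cbox u v"
      proof (rule image_eqI)
        show "p = ?g (?h p)" by (simp add: case_prod_beta)
        show "?h p \<in> cbox u v"
          using p by (auto simp: mem_box_cart forall_2 cbox_Pair_eq case_prod_beta)
      qed
    qed
  qed
  have hbox: "?h ` cbox p q = cbox (?h p) (?h q)" for p q
  proof -
    have "?g ` cbox (?h p) (?h q) = cbox p q" by (subst gbox) (auto split: prod.splits)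
    then have "?h ` cbox p q = ?h ` ?g ` cbox (?h p) (?h q)" by (simp only:)
    also have "\<dots> = cbox (?h p) (?h q)"
    proof -
      have "?h (?g v) = v" for v by (simp add: vec_eq_iff forall_2)
      then show ?thesis unfolding image_image by (simp only: image_ident)
    qed
    finally show ?thesis .
  qed
  have "(f has_integral integral (cbox (a, c) (b, d)) f) (cbox (a, c) (b, d))"
    using assms integrable_continuous integrable_integral by blast
  then have "((\<lambda>v. f (?g v)) has_integral (1 / 1) *\<^sub>R integral (cbox (a, c) (b, d)) f) (?h ` cbox (a, c) (b, d))"
  proof (rule has_integral_twiddle[where g = ?g and h = ?h, rotated -1])
    show "\<exists>w z. ?g ` cbox u v = cbox w z" for u v by (intro exI) (rule gbox)
    show "\<exists>w z. ?h ` cbox u v = cbox w z" for u v by (intro exI) (rule hbox)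
    show "measure lborel (?g ` cbox u v) = 1 * measure lborel (cbox u v)" for u v
    proof -
      have "cbox u v = {} \<longleftrightarrow> v $ 1 < u $ 1 \<or> v $ 2 < u $ 2"
        unfolding interval_eq_empty_cart using forall_2[of "\<lambda>i. \<not> v $ i < u $ i"] by blast
      then show ?thesis
        unfolding gbox content_Pair content_cbox_if_cart by (auto simp: UNIV_2 content_real_if)
    qed
  qed (auto simp: vec_eq_iff forall_2 intro!: continuous_intros)
  then have "((\<lambda>v. f (?g v)) has_integral integral (cbox (a, c) (b, d)) f) (cbox (vector [a, c]) (vector [b, d]))"
    unfolding hbox by simp
  then show ?thesis
    using integral_prod_continuous[OF assms] by (simp add: integral_unique)
qed

text \<open>The map \<open>w - c * cnj w\<close> after \<open>G\<close> has Jacobian (1 - |c|^2)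
  |G'|^2. It is injective on the open rectangle and sends it into a disc of area
  \<open>pi * M\<^sup>2\<close>. Injectivity is asked only in the interior, because the exponential
  identifies opposite edges of a rectangle of height \<open>2 * pi\<close>.\<close>

lemma holomorphic_area_bound:
  fixes G :: "complex \<Rightarrow> complex"
  assumes holG: "G holomorphic_on U" and U: "open U"
    and sub: "\<And>x y. \<lbrakk>x \<in> {a..b}; y \<in> {p..q}\<rbrakk> \<Longrightarrow> Complex x y \<in> U"
    and inj: "\<And>x y x' y'. \<lbrakk>x \<in> {a<..<b}; y \<in> {p<..<q}; x' \<in> {a<..<b}; y' \<in> {p<..<q};
      G (Complex x y) = G (Complex x' y')\<rbrakk> \<Longrightarrow> x = x' \<and> y = y'"
    and c: "norm c < 1" and M: "M \<ge> 0"
    and bound: "\<And>x y. \<lbrakk>x \<in> {a<..<b}; y \<in> {p<..<q}\<rbrakk> \<Longrightarrow>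
      norm (G (Complex x y) - c * cnj (G (Complex x y))) \<le> M"
  shows "(1 - (norm c)\<^sup>2) *
    integral {a..b} (\<lambda>x. integral {p..q} (\<lambda>y. (norm (deriv G (Complex x y)))\<^sup>2)) \<le> pi * M\<^sup>2"
proof -
  define L where "L w = w - c * cnj w" for w
  define C where "C v = Complex (v $ 1) (v $ 2)" for v :: "real^2"
  define V where "V w = (vector [Re w, Im w] :: real^2)" for w
  define H where "H v = V (L (G (C v)))" for v
  define H' where "H' v h = V (L (deriv G (C v) * C h))" for v h
  define S where "S = box (vector [a, p]) (vector [b, q] :: real^2)"
  have S: "v $ 1 \<in> {a<..<b}" "v $ 2 \<in> {p<..<q}" if "v \<in> S" for v :: "real^2"
    using that by (auto simp: S_def mem_box_cart forall_2)
  \<comment> \<open>A difference in the kernel of \<open>L\<close> would equal its own conjugate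
    times \<open>c\<close>, which \<open>norm c < 1\<close> permits only for 0.\<close>
  have L_inj: "w = w'" if "L w = L w'" for w w'
  proof -
    have "w - w' = c * cnj (w - w')" using that by (simp add: L_def algebra_simps)
    then have "norm (w - w') = norm c * norm (w - w')" by (metis norm_mult complex_mod_cnj)
    then show ?thesis using c by simp
  qed
  have blC: "bounded_linear C"
    unfolding linear_conv_bounded_linear[symmetric]
    by (rule linearI) (simp_all add: C_def complex_eq_iff)
  have blV: "bounded_linear V"
    unfolding linear_conv_bounded_linear[symmetric]
    by (rule linearI) (simp_all add: V_def vec_eq_iff forall_2)
  have blL: "bounded_linear L"
    unfolding linear_conv_bounded_linear[symmetric]
    by (rule linearI) (simp_all add: L_def scaleR_conv_of_real algebra_simps)
  have derG: "(G has_derivative (*) (deriv G (C v))) (at (C v))" if "C v \<in> U" for v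
    using holomorphic_derivI[OF holG U that] by (simp add: has_field_derivative_def)
  have derH: "(H has_derivative H' v) (at v within S)" if "v \<in> S" for v
  proof -
    have CU: "C v \<in> U" unfolding C_def using S[OF that] by (intro sub) auto
    have "((\<lambda>v. G (C v)) has_derivative (\<lambda>h. deriv G (C v) * C h)) (at v within S)"
      by (rule has_derivative_compose[OF bounded_linear_imp_has_derivative[OF blC] derG[OF CU]])
    from bounded_linear.has_derivative[OF blV bounded_linear.has_derivative[OF blL this]]
    show ?thesis unfolding H_def H'_def .
  qed
  have det: "det (matrix (H' v)) = (1 - (norm c)\<^sup>2) * (norm (deriv G (C v)))\<^sup>2" for v
    by (simp add: det_2 matrix_def H'_def V_def L_def C_def axis_def cmod_power2)
      (simp add: power2_eq_square algebra_simps)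
  have pos: "1 - (norm c)\<^sup>2 > 0" using c by (simp add: power_less_one_iff abs_square_less_1)
  have contU: "continuous_on U (deriv G)"
    by (intro holomorphic_on_imp_continuous_on holomorphic_deriv holG U)
  have cont: "continuous_on (cbox (a, p) (b, q)) (\<lambda>(x, y). (norm (deriv G (Complex x y)))\<^sup>2)"
    unfolding case_prod_beta
    by (intro continuous_intros continuous_on_compose2[OF contU])
      (use sub in \<open>auto simp: cbox_Pair_eq complex_eq intro!: continuous_intros\<close>)
  have "continuous_on (cbox (vector [a, p]) (vector [b, q])) (\<lambda>v. (norm (deriv G (C v)))\<^sup>2)"
    by (intro continuous_intros continuous_on_compose2[OF contU] linear_continuous_on[OF blC])
      (use sub in \<open>auto simp: C_def mem_box_cart forall_2\<close>)
  then have "(\<lambda>v. (norm (deriv G (C v)))\<^sup>2) integrable_on S"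
    unfolding S_def by (simp add: integrable_continuous integrable_on_open_interval)
  then have int: "(\<lambda>v. \<bar>det (matrix (H' v))\<bar>) integrable_on S"
    unfolding det using pos by (simp add: abs_mult)
  have injH: "inj_on H S"
  proof (rule inj_onI)
    fix u v assume uv: "u \<in> S" "v \<in> S" "H u = H v"
    then have "L (G (C u)) = L (G (C v))"
      by (simp add: H_def V_def vec_eq_iff forall_2 complex_eq_iff)
    then have "G (C u) = G (C v)" by (rule L_inj)
    then show "u = v" using inj[of "u $ 1" "u $ 2" "v $ 1" "v $ 2"] S uv
      by (simp add: C_def vec_eq_iff forall_2)
  qed
  have sets: "S \<in> sets lebesgue" by (simp add: S_def)
  have meas: "H ` S \<in> lmeasurable"
    using measurable_differentiable_image_eq[OF sets derH injH] int by simp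
  have "H ` S \<subseteq> cball 0 M"
  proof (clarsimp)
    fix v assume "v \<in> S"
    moreover have "norm (V w) = norm w" for w
      by (simp add: V_def norm_vec_def L2_set_def UNIV_2 cmod_def)
    ultimately show "norm (H v) \<le> M"
      unfolding H_def using bound S by (simp add: L_def C_def)
  qed
  then have "measure lebesgue (H ` S) \<le> measure lebesgue (cball (0::real^2) M)"
    by (intro measure_mono_fmeasurable fmeasurableD meas) auto
  also have "\<dots> = pi * M\<^sup>2"
    using M by (simp add: content_cball unit_ball_vol_2)
  also have "measure lebesgue (H ` S) = integral S (\<lambda>v. \<bar>det (matrix (H' v))\<bar>)"
    by (rule measure_differentiable_image_eq[OF sets derH injH int])
  also have "\<dots> = (1 - (norm c)\<^sup>2) * integral S (\<lambda>v. (norm (deriv G (C v)))\<^sup>2)"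
    unfolding det using pos by (simp add: abs_mult)
  also have "integral S (\<lambda>v. (norm (deriv G (C v)))\<^sup>2)
    = integral {a..b} (\<lambda>x. integral {p..q} (\<lambda>y. (norm (deriv G (Complex x y)))\<^sup>2))"
    unfolding S_def integral_open_interval C_def
    using integral_cbox_real2[OF cont] by simp
  finally show ?thesis .
qed

section \<open>Expansions and their estimates on circles\<close>

text \<open>Two successive difference quotients at 0, each with its removable singularity filled in.
  The identity holds even outside the disc, since there the quotients define
  \<open>Q\<close>.\<close>

lemma second_order_expansion:
  assumes holP: "P holomorphic_on ball 0 1"
  obtains Q where "Q holomorphic_on ball 0 1"
    "\<And>w. P w = P 0 + deriv P 0 * w + w\<^sup>2 * Q w"
proof -
  define P1 where "P1 z = (if z = 0 then deriv P 0 else (P z - P 0) / (z - 0))" for z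
  define Q where "Q z = (if z = 0 then deriv P1 0 else (P1 z - P1 0) / (z - 0))" for z
  have "P1 holomorphic_on ball 0 1"
    unfolding P1_def by (rule pole_lemma_open[OF holP open_ball])
  then have "Q holomorphic_on ball 0 1"
    unfolding Q_def by (rule pole_lemma_open[OF _ open_ball])
  moreover have "P w = P 0 + deriv P 0 * w + w\<^sup>2 * Q w" for w
    by (simp add: Q_def P1_def power2_eq_square field_simps)
  ultimately show ?thesis by (rule that)
qed

text \<open>On \<open>norm z = r\<close> one has \<open>cnj z = r^2 / z\<close>, so subtracting
  \<open>b * r^2\<close> times the conjugate removes the term \<open>b * z\<close> and leaves (1 -
  |b|^2 r^4) / z. The remainder z^3 q at most doubles.\<close>

lemma reciprocal_expansion_bound:
  assumes b: "norm b * r\<^sup>2 \<le> 1" and r: "0 < r" and z: "norm z = r" and q: "norm q \<le> K"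
  shows "norm ((1 / z + b * z + z ^ 3 * q) - b * of_real (r\<^sup>2) * cnj (1 / z + b * z + z ^ 3 * q)) \<le> 1 / r + 2 * K * r ^ 3"
proof -
  let ?c = "b * of_real (r\<^sup>2)"
  have zz: "z * cnj z = of_real (r\<^sup>2)"
    using z by (simp add: complex_norm_square[symmetric])
  have z0: "z \<noteq> 0" using z r by auto
  have cz: "cnj z = of_real (r\<^sup>2) / z" using zz z0 by (simp add: field_simps)
  have main: "(1 / z + b * z) - ?c * cnj (1 / z + b * z) = of_real (1 - (norm b * r\<^sup>2)\<^sup>2) / z"
  proof -
    have "of_real (1 - (norm b * r\<^sup>2)\<^sup>2) = 1 - b * cnj b * of_real (r\<^sup>2) * of_real (r\<^sup>2)"
      using complex_norm_square[of b] by (simp add: power_mult_distrib power2_eq_square)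
    then show ?thesis
      unfolding complex_cnj_add complex_cnj_mult complex_cnj_divide cz complex_cnj_one
      using z0 r by (simp add: field_simps) 
  qed
  have "norm (of_real (1 - (norm b * r\<^sup>2)\<^sup>2) / z) \<le> 1 / r"
  proof -
    have "(norm b * r\<^sup>2)\<^sup>2 \<le> 1" using b by (simp add: power_le_one)
    then have "norm (of_real (1 - (norm b * r\<^sup>2)\<^sup>2) :: complex) \<le> 1"
      unfolding norm_of_real by simp
    then show ?thesis using z r by (simp add: norm_divide divide_right_mono)
  qed
  moreover have "norm (z ^ 3 * q - ?c * cnj (z ^ 3 * q)) \<le> 2 * K * r ^ 3"
  proof -
    have 1: "norm (z ^ 3 * q) \<le> K * r ^ 3"
      using q r z by (simp add: norm_mult norm_power mult.commute mult_left_mono)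
    have "norm ?c \<le> 1" using b by (simp add: norm_mult norm_power)
    then have "norm (?c * cnj (z ^ 3 * q)) \<le> 1 * norm (z ^ 3 * q)"
      unfolding norm_mult[of ?c] complex_mod_cnj by (rule mult_right_mono) simp
    with 1 norm_triangle_ineq4[of "z ^ 3 * q" "?c * cnj (z ^ 3 * q)"] show ?thesis by simp
  qed
  moreover have eq: "(1 / z + b * z + z ^ 3 * q) - ?c * cnj (1 / z + b * z + z ^ 3 * q)
    = of_real (1 - (norm b * r\<^sup>2)\<^sup>2) / z + (z ^ 3 * q - ?c * cnj (z ^ 3 * q))"
    unfolding main[symmetric] by (simp add: algebra_simps)
  ultimately show ?thesis
    unfolding eq by (intro norm_triangle_le) linarith
qed

text \<open>
  On \<open>norm z = s\<close> one has \<open>cnj z = s\<^sup>2 / z\<close>, so the cross terms of the squared modulus are the real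
  part of a holomorphic function \<open>N\<close> with \<open>N 0 = 0\<close> and integrate to zero.
\<close>

lemma circle_integral_lower_bound:
  fixes b :: complex
  assumes holE: "E holomorphic_on ball 0 1" and E0: "E 0 = 0" and s: "0 < s" "s < 1"
  shows "2 * pi * (1 / s\<^sup>2 + (norm b)\<^sup>2 * s\<^sup>2) \<le>
    integral {0..2*pi} (\<lambda>\<theta>. let z = of_real s * cis \<theta> in (norm (- 1 / z + b * z + z * E z))\<^sup>2)"
proof -
  \<comment> \<open>Collects both cross products: the one between \<open>- 1 / z\<close> and
    \<open>b * z\<close>, and the one between their sum and \<open>z * E z\<close>.\<close>
  define N where "N z = 2 * ((- (z\<^sup>2) / of_real (s\<^sup>2) + cnj b * of_real (s\<^sup>2)) * E z - b * z\<^sup>2 / of_real (s\<^sup>2))" for z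
  have N0: "N 0 = 0" by (simp add: N_def E0)
  have holN: "N holomorphic_on ball 0 1"
    unfolding N_def by (intro holomorphic_intros holE) (use s in auto)
  have le: "1 / s\<^sup>2 + (norm b)\<^sup>2 * s\<^sup>2 + Re (N z) \<le> (norm (- 1 / z + b * z + z * E z))\<^sup>2"
    if z: "norm z = s" for z
  proof -
    have zz: "z * cnj z = of_real (s\<^sup>2)"
      using z by (simp add: complex_norm_square[symmetric])
    have z0: "z \<noteq> 0" using z s by auto
    have cz: "cnj z = of_real (s\<^sup>2) / z" using zz z0 by (simp add: field_simps)
    define u where "u = - 1 / z + b * z"
    have cu: "cnj u = - z / of_real (s\<^sup>2) + cnj b * of_real (s\<^sup>2) / z"
      unfolding u_def using s z0 by (simp add: cz)
    have sq: "(norm (x + y))\<^sup>2 = (norm x)\<^sup>2 + (norm y)\<^sup>2 + 2 * Re (cnj x * y)" for x y :: complex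
      unfolding cmod_power2 by (simp add: power2_eq_square algebra_simps)
    have "(norm u)\<^sup>2 = 1 / s\<^sup>2 + (norm b)\<^sup>2 * s\<^sup>2 + 2 * Re (cnj (- 1 / z) * (b * z))"
      unfolding u_def sq by (simp add: norm_divide norm_mult z power_mult_distrib power_divide)
    also have "cnj (- 1 / z) = - z / of_real (s\<^sup>2)" using s z0 by (simp add: cz)
    finally have u: "(norm u)\<^sup>2 = 1 / s\<^sup>2 + (norm b)\<^sup>2 * s\<^sup>2 + 2 * Re (- z / of_real (s\<^sup>2) * (b * z))" .
    \<comment> \<open>The discarded square of \<open>norm (z * E z)\<close> is the source of the
      inequality.\<close>
    have "(norm (u + z * E z))\<^sup>2 \<ge> (norm u)\<^sup>2 + 2 * Re (cnj u * (z * E z))"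
      unfolding sq by simp
    moreover have "N z = 2 * (- z / of_real (s\<^sup>2) * (b * z)) + 2 * (cnj u * (z * E z))"
      unfolding N_def cu using z0 s by (simp add: field_simps power2_eq_square)
    then have "Re (N z) = 2 * Re (- z / of_real (s\<^sup>2) * (b * z)) + 2 * Re (cnj u * (z * E z))"
      by (metis plus_complex.sel(1) mult_2)
    ultimately show ?thesis unfolding u_def[symmetric] u by simp
  qed
  have "((\<lambda>\<theta>. Re (N (of_real s * cis \<theta>))) has_integral 0) {0..2*pi}"
    using has_integral_Re[OF mean_value_circle[OF holN s]] N0 by simp
  moreover have "((\<lambda>\<theta>. 1 / s\<^sup>2 + (norm b)\<^sup>2 * s\<^sup>2) has_integral 2 * pi * (1 / s\<^sup>2 + (norm b)\<^sup>2 * s\<^sup>2)) {0..2*pi}"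
    using has_integral_const_real[of "1 / s\<^sup>2 + (norm b)\<^sup>2 * s\<^sup>2" 0 "2*pi"] by simp
  ultimately have 1: "((\<lambda>\<theta>. 1 / s\<^sup>2 + (norm b)\<^sup>2 * s\<^sup>2 + Re (N (of_real s * cis \<theta>)))
      has_integral 2 * pi * (1 / s\<^sup>2 + (norm b)\<^sup>2 * s\<^sup>2) + 0) {0..2*pi}"
    by (intro has_integral_add)
  have "continuous_on {0..2*pi} (\<lambda>\<theta>. (norm (- 1 / (of_real s * cis \<theta>) + b * (of_real s * cis \<theta>) + of_real s * cis \<theta> * E (of_real s * cis \<theta>)))\<^sup>2)"
    by (intro continuous_intros continuous_on_compose2[OF holomorphic_on_imp_continuous_on[OF holE]])
      (use s in \<open>auto simp: norm_mult\<close>)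
  then have "(\<lambda>\<theta>. (norm (- 1 / (of_real s * cis \<theta>) + b * (of_real s * cis \<theta>) + of_real s * cis \<theta> * E (of_real s * cis \<theta>)))\<^sup>2) integrable_on {0..2*pi}"
    by (rule integrable_continuous_real)
  from has_integral_le[OF 1 integrable_integral[OF this]] show ?thesis
    using le s by (simp add: Let_def norm_mult)
qed

section \<open>The area inequality and its limit\<close>

text \<open>Compares two estimates for the area of the image of the annulus between radii
  \<open>r\<close> and \<open>t\<close> under \<open>h\<close>, the reciprocal of z / P(z^2).
  Integrating the circle estimate bounds it from below; containment in a disc after the linear map
  with \<open>c\<close> bounds it from above. Taking \<open>t < 1\<close> keeps the closed rectangle
  inside the half-plane \<open>U\<close>.\<close>

lemma odd_area_inequality:
  assumes holP: "P holomorphic_on ball 0 1" and holQ: "Q holomorphic_on ball 0 1"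
    and P: "\<And>w. norm w < 1 \<Longrightarrow> P w = 1 + b * w + w\<^sup>2 * Q w"
    and nz: "\<And>w. norm w < 1 \<Longrightarrow> P w \<noteq> 0"
    and inj: "inj_on (\<lambda>z. z / P (z\<^sup>2)) (ball 0 1)"
    and K: "\<And>w. norm w \<le> r\<^sup>2 \<Longrightarrow> norm (Q w) \<le> K"
    and r: "0 < r" "r < t" "t < 1" and br: "norm b * r\<^sup>2 < 1"
  shows "(1 - (norm b * r\<^sup>2)\<^sup>2) * (1 / r\<^sup>2 - 1 / t\<^sup>2 + (norm b)\<^sup>2 * (t\<^sup>2 - r\<^sup>2))
    \<le> (1 / r + 2 * K * r ^ 3)\<^sup>2"
proof -
  define F where "F z = z / P (z\<^sup>2)" for z
  define h where "h z = 1 / z + b * z + z ^ 3 * Q (z\<^sup>2)" for z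
  \<comment> \<open>Chosen so that z h'(z) = -1/z + b z + z E(z), which is the derivative of
    \<open>G\<close> in the coordinate log z.\<close>
  define E where "E z = 3 * z\<^sup>2 * Q (z\<^sup>2) + 2 * z ^ 4 * deriv Q (z\<^sup>2)" for z
  define G where "G \<zeta> = h (exp \<zeta>)" for \<zeta>
  define U where "U = {\<zeta>. Re \<zeta> < 0}"
  define c where "c = b * of_real (r\<^sup>2)"
  have sq: "norm (z\<^sup>2) < 1" if "norm z < 1" for z :: complex
    using that by (simp add: norm_power power_less_one_iff)
  have hF: "1 / F z = h z" if "norm z < 1" "z \<noteq> 0" for z
    using that nz[OF sq[OF that(1)]] P[OF sq[OF that(1)]]
    by (simp add: F_def h_def divide_simps) (simp add: power2_eq_square power3_eq_cube power4_eq_xxxx algebra_simps)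
  have hol2: "(\<lambda>z. g (z\<^sup>2)) holomorphic_on ball 0 1" if "g holomorphic_on ball 0 1" for g
  proof -
    have "(\<lambda>z::complex. z\<^sup>2) holomorphic_on ball 0 1" by (intro holomorphic_intros)
    moreover have "(\<lambda>z::complex. z\<^sup>2) ` ball 0 1 \<subseteq> ball 0 1" using sq by auto
    ultimately show ?thesis using holomorphic_on_compose_gen[OF _ that] by (simp add: o_def)
  qed
  have holF: "F holomorphic_on ball 0 1"
    unfolding F_def by (intro holomorphic_intros hol2 holP) (use nz sq in auto)
  have holE: "E holomorphic_on ball 0 1"
    unfolding E_def by (intro holomorphic_intros hol2 holQ holomorphic_deriv) auto
  have E0: "E 0 = 0" by (simp add: E_def)
  have exp_lt: "norm (exp \<zeta>) < 1" if "\<zeta> \<in> U" for \<zeta> :: complex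
    using that by (simp add: U_def norm_exp_eq_Re)
  have openU: "open U" unfolding U_def by (rule open_halfspace_Re_lt)
  have dG: "(G has_field_derivative (- 1 / exp \<zeta> + b * exp \<zeta> + exp \<zeta> * E (exp \<zeta>))) (at \<zeta>)"
    if "\<zeta> \<in> U" for \<zeta>
  proof -
    define z where "z = exp \<zeta>"
    have z: "norm z < 1" "z \<noteq> 0" using exp_lt[OF that] by (auto simp: z_def)
    have dQ: "((\<lambda>z. Q (z\<^sup>2)) has_field_derivative deriv Q (z\<^sup>2) * (2 * z)) (at z)"
      by (rule DERIV_chain2[of Q _ "\<lambda>z. z\<^sup>2", OF has_deriv_unit_disc[OF holQ sq[OF z(1)]]]) (auto intro!: derivative_eq_intros)
    have d1: "((\<lambda>z. 1 / z) has_field_derivative - 1 / z\<^sup>2) (at z)"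
      using z by (auto intro!: derivative_eq_intros simp: power2_eq_square)
    have d2: "((\<lambda>z. b * z) has_field_derivative b) (at z)"
      by (auto intro!: derivative_eq_intros)
    have d3: "((\<lambda>z. z ^ 3) has_field_derivative 3 * z\<^sup>2) (at z)"
      by (auto intro!: derivative_eq_intros)
    have "(h has_field_derivative (- 1 / z\<^sup>2 + b + 3 * z\<^sup>2 * Q (z\<^sup>2) + z ^ 3 * (deriv Q (z\<^sup>2) * (2 * z)))) (at z)"
      unfolding h_def using DERIV_add[OF DERIV_add[OF d1 d2] DERIV_mult[OF d3 dQ]]
      by (simp only: mult.commute[of "z ^ 3"] add.assoc)
    from DERIV_chain2[of h _ exp, OF this[unfolded z_def] DERIV_exp]
    have "(G has_field_derivative (- 1 / z\<^sup>2 + b + 3 * z\<^sup>2 * Q (z\<^sup>2) + z ^ 3 * (deriv Q (z\<^sup>2) * (2 * z))) * z) (at \<zeta>)"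
      unfolding G_def z_def .
    moreover have "(- 1 / z\<^sup>2 + b + 3 * z\<^sup>2 * Q (z\<^sup>2) + z ^ 3 * (deriv Q (z\<^sup>2) * (2 * z))) * z
      = - 1 / z + b * z + z * E z"
      using z by (simp add: E_def field_simps power2_eq_square power3_eq_cube power4_eq_xxxx)
    ultimately show ?thesis by (simp add: z_def)
  qed
  then have holG: "G holomorphic_on U"
    using openU by (auto simp: holomorphic_on_open)
  have polar: "exp (Complex x y) = of_real (exp x) * cis y" for x y
    by (simp add: exp_eq_polar)
  have ln: "ln r < ln t" "ln t < 0" using r by auto
  have inU: "Complex x y \<in> U" if "x \<in> {ln r..ln t}" for x y
    using that ln by (auto simp: U_def)
  have exp_in: "norm (exp (Complex x y)) < 1" if "ln r < x" "x < ln t" for x y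
    by (rule exp_lt[OF inU]) (use that in auto)
  have K0: "K \<ge> 0" using order_trans[OF norm_ge_zero K[of 0]] by simp
  have "(1 - (norm c)\<^sup>2) * integral {ln r..ln t} (\<lambda>x. integral {0..2*pi}
      (\<lambda>y. (norm (deriv G (Complex x y)))\<^sup>2)) \<le> pi * (1 / r + 2 * K * r ^ 3)\<^sup>2"
  proof (rule holomorphic_area_bound[OF holG openU])
    fix x y x' y' assume xy: "x \<in> {ln r<..<ln t}" "y \<in> {0<..<2*pi}" "x' \<in> {ln r<..<ln t}" "y' \<in> {0<..<2*pi}"
      and eq: "G (Complex x y) = G (Complex x' y')"
    have in1: "norm (exp (Complex x y)) < 1" "norm (exp (Complex x' y')) < 1"
      using xy exp_in by (simp_all only: greaterThanLessThan_iff)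
    have "1 / F (exp (Complex x y)) = 1 / F (exp (Complex x' y'))"
      using eq in1 by (simp add: hF G_def)
    then have "F (exp (Complex x y)) = F (exp (Complex x' y'))" by simp
    then have "exp (Complex x y) = exp (Complex x' y')"
      using inj in1 unfolding F_def[abs_def, symmetric] by (auto dest!: inj_onD)
    \<comment> \<open>The imaginary parts lie strictly between 0 and \<open>2 * pi\<close>, where
      the exponential is injective.\<close>
    then have "Complex x y = Complex x' y'"
      by (rule exp_complex_eqI[rotated]) (use xy in auto)
    then show "x = x' \<and> y = y'" by simp
  next
    show "norm c < 1" using br by (simp add: c_def norm_mult norm_power)
    show "0 \<le> 1 / r + 2 * K * r ^ 3" using r K0 by simp
    fix x y assume x: "x \<in> {ln r<..<ln t}" and "y \<in> {0<..<2*pi}"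
    define z where "z = exp (Complex x y)"
    have z: "norm z < 1" using x exp_in unfolding z_def by (simp only: greaterThanLessThan_iff)
    have rz: "r \<le> norm z"
    proof -
      have "exp (ln r) \<le> exp x" using x by simp
      then show ?thesis using r by (simp add: z_def norm_exp_eq_Re)
    qed
    have "linear (\<lambda>w. w - c * cnj w)"
      by (rule linearI) (simp_all add: scaleR_conv_of_real algebra_simps)
    moreover have "norm (1 / F y - c * cnj (1 / F y)) \<le> 1 / r + 2 * K * r ^ 3" if y: "norm y = r" for y
    proof -
      have y01: "norm y < 1" "y \<noteq> 0" using r y by auto
      show ?thesis
        unfolding hF[OF y01] h_def c_def
        by (rule reciprocal_expansion_bound[OF less_imp_le[OF br] r(1) y K]) (simp add: norm_power y)
    qed
    ultimately have "norm (1 / F z - c * cnj (1 / F z)) \<le> 1 / r + 2 * K * r ^ 3"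
      using reciprocal_image_bound[OF holF _ _ r(1) _ _ _ rz z, of "\<lambda>w. w - c * cnj w"]
        inj r by (simp add: F_def[abs_def])
    moreover have "1 / F z = G (Complex x y)" using z by (simp add: hF G_def z_def)
    ultimately show "norm (G (Complex x y) - c * cnj (G (Complex x y))) \<le> 1 / r + 2 * K * r ^ 3" by simp
  qed (use inU in auto)
  moreover have "pi * (1 / r\<^sup>2 - 1 / t\<^sup>2 + (norm b)\<^sup>2 * (t\<^sup>2 - r\<^sup>2)) \<le>
    integral {ln r..ln t} (\<lambda>x. integral {0..2*pi} (\<lambda>y. (norm (deriv G (Complex x y)))\<^sup>2))"
  proof -
    \<comment> \<open>A primitive in x of the circle lower bound at radius
      \<open>exp x\<close>.\<close>
    let ?A = "\<lambda>x. pi * (- exp (- 2 * x) + (norm b)\<^sup>2 * exp (2 * x))"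
    have e: "exp (- 2 * x) = 1 / (exp x)\<^sup>2" "exp (2 * x) = (exp x)\<^sup>2" for x :: real
      by (simp_all add: exp_double exp_minus inverse_eq_divide)
    have i1: "((\<lambda>x. 2 * pi * (1 / (exp x)\<^sup>2 + (norm b)\<^sup>2 * (exp x)\<^sup>2)) has_integral (?A (ln t) - ?A (ln r))) {ln r..ln t}"
    proof (rule fundamental_theorem_of_calculus)
      fix x assume "x \<in> {ln r..ln t}"
      show "(?A has_vector_derivative 2 * pi * (1 / (exp x)\<^sup>2 + (norm b)\<^sup>2 * (exp x)\<^sup>2)) (at x within {ln r..ln t})"
      proof -
        have "(?A has_real_derivative pi * (2 * exp (- 2 * x) + (norm b)\<^sup>2 * (2 * exp (2 * x)))) (at x within {ln r..ln t})"
          by (auto intro!: derivative_eq_intros)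
        then show ?thesis
          unfolding e has_real_derivative_iff_has_vector_derivative[symmetric] by (simp only: distrib_left ac_simps)
      qed
    qed (use ln in simp)
    have A: "?A (ln t) - ?A (ln r) = pi * (1 / r\<^sup>2 - 1 / t\<^sup>2 + (norm b)\<^sup>2 * (t\<^sup>2 - r\<^sup>2))"
      unfolding e using r by (simp add: algebra_simps)
    have i2: "(\<lambda>x. integral {0..2*pi} (\<lambda>y. (norm (deriv G (Complex x y)))\<^sup>2)) integrable_on {ln r..ln t}"
    proof -
      have contU: "continuous_on U (deriv G)"
        by (intro holomorphic_on_imp_continuous_on holomorphic_deriv holG openU)
      have "continuous_on (cbox (ln r, 0) (ln t, 2*pi)) (\<lambda>(x, y). (norm (deriv G (Complex x y)))\<^sup>2)"
        unfolding case_prod_beta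
        by (intro continuous_intros continuous_on_compose2[OF contU])
          (use inU in \<open>auto simp: cbox_Pair_eq complex_eq intro!: continuous_intros\<close>)
      from integral_integrable_2dim[OF this] show ?thesis by simp
    qed
    have le: "2 * pi * (1 / (exp x)\<^sup>2 + (norm b)\<^sup>2 * (exp x)\<^sup>2)
        \<le> integral {0..2*pi} (\<lambda>y. (norm (deriv G (Complex x y)))\<^sup>2)" if x: "x \<in> {ln r..ln t}" for x
    proof -
      have "exp x < 1" using x ln by simp
      moreover have "deriv G (Complex x y) = (let z = of_real (exp x) * cis y in - 1 / z + b * z + z * E z)" for y
        unfolding DERIV_imp_deriv[OF dG[OF inU[OF x]]] polar Let_def ..
      ultimately show ?thesis
        using circle_integral_lower_bound[OF holE E0, of "exp x" b] by (simp add: Let_def)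
    qed
    show ?thesis
      using has_integral_le[OF i1 integrable_integral[OF i2] le] unfolding A .
  qed
  moreover have nc: "norm c = norm b * r\<^sup>2" by (simp add: c_def norm_mult norm_power)
  moreover have "(norm b * r\<^sup>2)\<^sup>2 \<le> 1" using br by (simp add: power_le_one)
  ultimately have "(1 - (norm b * r\<^sup>2)\<^sup>2) * (pi * (1 / r\<^sup>2 - 1 / t\<^sup>2 + (norm b)\<^sup>2 * (t\<^sup>2 - r\<^sup>2)))
    \<le> pi * (1 / r + 2 * K * r ^ 3)\<^sup>2"
    unfolding nc by (meson diff_ge_0_iff_ge mult_left_mono order_trans)
  then show ?thesis
    unfolding mult.left_commute[of _ pi] by (simp only: mult_le_cancel_left_pos pi_gt_zero)
qed

text \<open>After multiplication of the area inequality by r^2 the constants 1 cancel, and the next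
  order in r gives B t^2 \<le> 1 / t^2 as \<open>r\<close> tends to 0. Then \<open>t\<close> tends
  to 1.\<close>

lemma odd_area_theorem:
  assumes holP: "P holomorphic_on ball 0 1" and P0: "P 0 = 1"
    and nz: "\<And>w. norm w < 1 \<Longrightarrow> P w \<noteq> 0"
    and inj: "inj_on (\<lambda>z. z / P (z\<^sup>2)) (ball 0 1)"
  shows "norm (deriv P 0) \<le> 1"
proof -
  obtain Q where holQ: "Q holomorphic_on ball 0 1"
    and P: "\<And>w. P w = 1 + deriv P 0 * w + w\<^sup>2 * Q w"
    using second_order_expansion[OF holP] P0 by auto
  define B where "B = (norm (deriv P 0))\<^sup>2"
  have "B * t\<^sup>2 \<le> 1 / t\<^sup>2" if t: "0 < t" "t < 1" for t :: real
  proof -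
    \<comment> \<open>One \<open>K\<close> must serve all \<open>r < t\<close> before the limit; it
      does because r^2 \<le> t.\<close>
    have "compact (Q ` cball 0 t)"
      using holQ t
      by (intro compact_continuous_image holomorphic_on_imp_continuous_on) (auto intro: holomorphic_on_subset)
    then obtain K where "\<forall>w\<in>cball 0 t. norm (Q w) \<le> K"
      by (auto dest!: compact_imp_bounded simp: bounded_iff)
    then have K: "norm (Q w) \<le> K" if "norm w \<le> t" for w using that by simp
    \<comment> \<open>\<open>D\<close> is r^2 times the gap in the area inequality;
      \<open>D'\<close> is that gap itself as a polynomial in \<open>r\<close>, free of negative
      powers.\<close>
    define D where "D r = (1 + 2 * K * r ^ 4)\<^sup>2 - (1 - B * r ^ 4) * (1 + r\<^sup>2 * (B * (t\<^sup>2 - r\<^sup>2) - 1 / t\<^sup>2))" for r :: real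
    define D' where "D' r = 4 * K * r\<^sup>2 + 4 * K\<^sup>2 * r ^ 6 + 1 / t\<^sup>2 - B * t\<^sup>2 + B * r\<^sup>2
      + B * r\<^sup>2 + B * r ^ 4 * (B * (t\<^sup>2 - r\<^sup>2) - 1 / t\<^sup>2)" for r :: real
    have D: "D r = r\<^sup>2 * D' r" for r
      unfolding D_def D'_def by algebra
    have "(D' \<longlongrightarrow> 1 / t\<^sup>2 - B * t\<^sup>2) (at_right 0)"
      unfolding D'_def by (rule tendsto_eq_intros refl | simp)+
    moreover have "\<forall>\<^sub>F r in at_right 0. norm (deriv P 0) * r\<^sup>2 < 1"
      by (rule order_tendstoD) (rule tendsto_eq_intros refl | simp)+
    then have "\<forall>\<^sub>F r in at_right 0. 0 \<le> D' r"
      using eventually_at_right_real[OF t(1)]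
    proof eventually_elim
      case (elim r)
      then have r: "0 < r" "r < t" by auto
      then have "r * r \<le> t * 1" using t by (intro mult_mono) auto
      then have r2: "r\<^sup>2 \<le> t" by (simp add: power2_eq_square)
      have "(1 - (norm (deriv P 0) * r\<^sup>2)\<^sup>2) * (1 / r\<^sup>2 - 1 / t\<^sup>2 + (norm (deriv P 0))\<^sup>2 * (t\<^sup>2 - r\<^sup>2))
        \<le> (1 / r + 2 * K * r ^ 3)\<^sup>2"
        by (rule odd_area_inequality[OF holP holQ P nz inj K r t(2) elim(1)]) (use r2 in auto)
      then have "r\<^sup>2 * ((1 - B * r ^ 4) * (1 / r\<^sup>2 - 1 / t\<^sup>2 + B * (t\<^sup>2 - r\<^sup>2))) \<le> r\<^sup>2 * (1 / r + 2 * K * r ^ 3)\<^sup>2"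
        by (intro mult_left_mono) (simp_all add: B_def power_mult_distrib flip: power_mult)
      moreover have "r\<^sup>2 * (1 / r + 2 * K * r ^ 3)\<^sup>2 = (1 + 2 * K * r ^ 4)\<^sup>2"
        using r by (simp add: field_simps eval_nat_numeral flip: power_mult_distrib)
      moreover have "r\<^sup>2 * ((1 - B * r ^ 4) * (1 / r\<^sup>2 - 1 / t\<^sup>2 + B * (t\<^sup>2 - r\<^sup>2)))
        = (1 - B * r ^ 4) * (1 + r\<^sup>2 * (B * (t\<^sup>2 - r\<^sup>2) - 1 / t\<^sup>2))"
      proof -
        have "x * (A * (y - u + w)) = A * (x * y + x * (w - u))" for x y A u w :: real
          by (simp add: algebra_simps)
        moreover have "r\<^sup>2 * (1 / r\<^sup>2) = 1" using r by simp
        ultimately show ?thesis by (simp only:)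
      qed
      ultimately have "0 \<le> r\<^sup>2 * D' r" unfolding D[symmetric] D_def by linarith
      then show ?case using r by (simp add: zero_le_mult_iff)
    qed
    ultimately have "0 \<le> 1 / t\<^sup>2 - B * t\<^sup>2"
      by (rule tendsto_lowerbound) simp
    then show ?thesis by simp
  qed
  then have "\<forall>\<^sub>F t in at_left 1. B * t\<^sup>2 \<le> 1 / t\<^sup>2"
    using eventually_at_left_real[of 0 "1::real"] by (auto elim!: eventually_mono)
  moreover have "((\<lambda>t. B * t\<^sup>2) \<longlongrightarrow> B) (at_left 1)" "((\<lambda>t::real. 1 / t\<^sup>2) \<longlongrightarrow> 1) (at_left 1)"
    by (rule tendsto_eq_intros refl | simp)+
  ultimately have "B \<le> 1"
    by (intro tendsto_le[of "at_left 1" "\<lambda>t. 1 / t\<^sup>2" 1 "\<lambda>t. B * t\<^sup>2" B]) auto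
  then show ?thesis unfolding B_def by (simp add: abs_square_le_1)
qed

section \<open>Bieberbach's bound by the square-root transform\<close>

text \<open>Write f(z) = z s(z)^2 and P = s(0) / s, so that z / P(z^2) is a constant multiple of the
  odd root of f(z^2). Then P'(0) = -s(0) s'(0) and f''(0) = 4 s(0) s'(0), which turns the bound 1
  into 4.\<close>

lemma Bieberbach_second_coeff_bound:
  assumes "class_S f"
  shows "norm (deriv (deriv f) 0) \<le> 4"
proof -
  have holf: "f holomorphic_on ball 0 1" and inj: "inj_on f (ball 0 1)"
    and f0: "f 0 = 0" and f1: "deriv f 0 = 1"
    using assms unfolding class_S_def class_A_def by auto
  define g where "g z = (if z = 0 then deriv f 0 else (f z - f 0) / (z - 0))" for z
  have holg: "g holomorphic_on ball 0 1"
    unfolding g_def by (rule pole_lemma_open[OF holf open_ball])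
  have fg: "f z = z * g z" for z by (simp add: g_def f0)
  have gnz: "g z \<noteq> 0" if "norm z < 1" for z
  proof (cases "z = 0")
    case False
    then have "f z \<noteq> f 0" using inj_onD[OF inj, of z 0] that by auto
    then show ?thesis using fg[of z] f0 by auto
  qed (simp add: g_def f1)
  have "simply_connected (ball (0::complex) 1)" by (simp add: convex_imp_simply_connected)
  then obtain s where hols: "s holomorphic_on ball 0 1"
    and s: "\<And>z. norm z < 1 \<Longrightarrow> g z = (s z)\<^sup>2"
    using holg gnz unfolding simply_connected_eq_holomorphic_sqrt[OF open_ball] by fastforce
  have snz: "s z \<noteq> 0" if "norm z < 1" for z
    using s[OF that] gnz[OF that] by auto
  have s0: "s 0 * s 0 = 1" using s[of 0] by (simp add: g_def f1 power2_eq_square)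
  \<comment> \<open>The factor \<open>s 0\<close>, a square root of 1, normalizes
    \<open>P 0 = 1\<close> for either branch of the root.\<close>
  define P where "P z = s 0 / s z" for z
  have sq: "norm (z\<^sup>2) < 1" if "norm z < 1" for z :: complex
    using that by (simp add: norm_power power_less_one_iff)
  have bound: "norm (deriv P 0) \<le> 1"
  proof (rule odd_area_theorem)
    show "P holomorphic_on ball 0 1"
      unfolding P_def by (intro holomorphic_intros hols) (use snz in auto)
    show "P 0 = 1" using snz[of 0] by (simp add: P_def)
    show "P w \<noteq> 0" if "norm w < 1" for w using snz[OF that] snz[of 0] by (simp add: P_def)
    show "inj_on (\<lambda>z. z / P (z\<^sup>2)) (ball 0 1)"
    proof (rule inj_onI)
      fix x y :: complex assume xy: "x \<in> ball 0 1" "y \<in> ball 0 1" "x / P (x\<^sup>2) = y / P (y\<^sup>2)"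
      have eq: "x * s (x\<^sup>2) = y * s (y\<^sup>2)"
        using xy(3) snz[of 0] by (simp add: P_def)
      have "f (x\<^sup>2) = (x * s (x\<^sup>2))\<^sup>2" "f (y\<^sup>2) = (y * s (y\<^sup>2))\<^sup>2"
        using xy sq by (simp_all add: fg s power_mult_distrib)
      then have "f (x\<^sup>2) = f (y\<^sup>2)" using eq by simp
      then have 2: "x\<^sup>2 = y\<^sup>2" using inj xy sq by (auto dest!: inj_onD)
      \<comment> \<open>Equal squares leave the sign open; cancelling the common nonzero factor in
        \<open>eq\<close> settles it.\<close>
      have "s (y\<^sup>2) \<noteq> 0" using xy sq snz by simp
      with eq[unfolded 2] show "x = y" by simp
    qed
  qed
  have "(P has_field_derivative - deriv s 0 / s 0) (at 0)"
    unfolding P_def using snz[of 0] s0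
    by (auto intro!: derivative_eq_intros has_deriv_unit_disc[OF hols] simp: field_simps)
  then have "deriv P 0 = - deriv s 0 / s 0" by (rule DERIV_imp_deriv)
  moreover have "1 / s 0 = s 0" using s0 snz[of 0] by (simp add: field_simps)
  ultimately have P': "deriv P 0 = - s 0 * deriv s 0"
    by (metis mult.commute mult_minus_left divide_inverse inverse_eq_divide)
  have "deriv (deriv f) 0 = 4 * (s 0 * deriv s 0)"
  proof -
    have d: "(f has_field_derivative (s z)\<^sup>2 + z * (2 * s z * deriv s z)) (at z)" if "norm z < 1" for z
    proof -
      have "((\<lambda>z. z * (s z)\<^sup>2) has_field_derivative (s z)\<^sup>2 + z * (2 * s z * deriv s z)) (at z)"
        by (auto intro!: derivative_eq_intros has_deriv_unit_disc[OF hols] that)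
      then show ?thesis
        by (rule has_field_derivative_transform_within_open[of _ _ _ "ball 0 1"]) (use that in \<open>auto simp: fg s\<close>)
    qed
    have hols': "deriv s holomorphic_on ball 0 1" by (intro holomorphic_deriv hols) auto
    have "((\<lambda>z. (s z)\<^sup>2 + z * (2 * s z * deriv s z)) has_field_derivative 4 * (s 0 * deriv s 0)) (at 0)"
      by (rule derivative_eq_intros has_deriv_unit_disc[OF hols] has_deriv_unit_disc[OF hols'] refl | simp)+
    then have "(deriv f has_field_derivative 4 * (s 0 * deriv s 0)) (at 0)"
      by (rule has_field_derivative_transform_within_open[of _ _ _ "ball 0 1"]) (auto simp: DERIV_imp_deriv[OF d])
    then show ?thesis by (rule DERIV_imp_deriv)
  qed
  with bound P' show ?thesis by (simp add: norm_mult)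
qed

section \<open>Quadratic polynomials in the cardioid class\<close>

text \<open>Both sides are averages with 1: the cardioid map is (1 + (1 + w)^2) / 2, and (1 + 2bz) /
  (1 + bz) is (1 + m(z)) / 2. Hence \<open>w\<close> is the principal root of \<open>m\<close> minus
  1.\<close>

lemma quadratic_in_S_star_car:
  assumes b: "norm b \<le> 1/3"
  shows "class_S_star_car (\<lambda>z. z + b * z\<^sup>2)"
proof -
  let ?F = "\<lambda>z. z + b * z\<^sup>2"
  have dF: "(?F has_field_derivative 1 + 2 * b * z) (at z)" for z
    by (auto intro!: derivative_eq_intros)
  then have derF: "deriv ?F z = 1 + 2 * b * z" for z
    by (rule DERIV_imp_deriv)
  define m where "m z = (1 + 3 * (b * z)) / (1 + b * z)" for z
  define w where "w z = csqrt (m z) - 1" for z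
  have bz: "norm (b * z) < 1/3" if "norm z < 1" for z
  proof (cases "b = 0")
    case False
    then have "norm b * norm z < norm b * 1" using that by (intro mult_strict_left_mono) auto
    with b show ?thesis by (simp add: norm_mult)
  qed auto
  have nz: "1 + b * z \<noteq> 0" if "norm z < 1" for z
  proof
    assume "1 + b * z = 0"
    then have "b * z = -1" by (simp add: add_eq_0_iff)
    with bz[OF that] show False by simp
  qed
  \<comment> \<open>This says |m - 3/4| < 3/4. With u = b z it reduces to 9 |u|^2 < 1, which is
    where 1/3 enters.\<close>
  have key: "3 * Re (m z) > 2 * (norm (m z))\<^sup>2" if "norm z < 1" for z
  proof -
    define u where "u = b * z"
    have u: "norm u < 1/3" "1 + u \<noteq> 0" using bz nz that by (auto simp: u_def)
    have "(norm u)\<^sup>2 < (1/3)\<^sup>2" by (rule power_strict_mono) (use u in auto)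
    then have u2: "(Re u)\<^sup>2 + (Im u)\<^sup>2 < 1/9" unfolding cmod_power2 by (simp add: power_divide)
    have pos: "(norm (1 + u))\<^sup>2 > 0" using u by simp
    have mz: "m z = (1 + 3 * u) * cnj (1 + u) / of_real ((norm (1 + u))\<^sup>2)"
      unfolding m_def u_def[symmetric] complex_div_cnj[of "1 + 3 * u"] ..
    have Re: "Re (m z) = (1 + 4 * Re u + 3 * ((Re u)\<^sup>2 + (Im u)\<^sup>2)) / (norm (1 + u))\<^sup>2"
      unfolding mz Re_divide_of_real by (simp add: power2_eq_square algebra_simps)
    have N: "(norm (m z))\<^sup>2 = (1 + 6 * Re u + 9 * ((Re u)\<^sup>2 + (Im u)\<^sup>2)) / (norm (1 + u))\<^sup>2"
      unfolding m_def u_def[symmetric] norm_divide power_divide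
      unfolding cmod_power2[of "1 + 3 * u"] by (simp add: power2_eq_square algebra_simps)
    have "2 * (1 + 6 * Re u + 9 * ((Re u)\<^sup>2 + (Im u)\<^sup>2)) < 3 * (1 + 4 * Re u + 3 * ((Re u)\<^sup>2 + (Im u)\<^sup>2))"
      using u2 by simp
    from divide_strict_right_mono[OF this pos] show ?thesis unfolding Re N times_divide_eq_right .
  qed
  have Re_pos: "Re (m z) > 0" if "norm z < 1" for z
    using key[OF that] zero_le_power2[of "norm (m z)"] by linarith
  have w_lt: "norm (w z) < 1" if "norm z < 1" for z
  proof -
    define s where "s = csqrt (m z)"
    have s2: "s\<^sup>2 = m z" by (simp add: s_def)
    have "Re s \<noteq> 0"
      using Re_pos[OF that] unfolding s2[symmetric] by (auto simp: power2_eq_square)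
    moreover have "Re s \<ge> 0" unfolding s_def by (rule Re_csqrt)
    ultimately have x: "Re s > 0" by simp
    define R where "R = (norm s)\<^sup>2"
    have R: "R = (Re s)\<^sup>2 + (Im s)\<^sup>2" by (simp add: R_def cmod_power2)
    \<comment> \<open>The goal |s - 1| < 1 amounts to R < 2 Re s, so the square of \<open>R\<close>
      has to stay below 4 (Re s)^2; \<open>key\<close> gives even the factor 3/2.\<close>
    have "2 * R\<^sup>2 < 3 * ((Re s)\<^sup>2 - (Im s)\<^sup>2)"
      using key[OF that] unfolding s2[symmetric] norm_power by (simp add: R_def power2_eq_square)
    moreover have "r < 4 * x" if "2 * r < 3 * (x - y)" "0 < x" "0 \<le> y" for r x y :: real
      using that by simp
    ultimately have "R\<^sup>2 < 4 * (Re s)\<^sup>2"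
      by (metis x zero_le_power2 zero_less_power)
    then have "R\<^sup>2 < (2 * Re s)\<^sup>2" by (simp only: power_mult_distrib) simp
    then have "R < 2 * Re s" by (rule power2_less_imp_less) (use x in simp)
    moreover have "(norm (s - 1))\<^sup>2 = R - 2 * Re s + 1"
      unfolding R cmod_power2 by (simp add: power2_diff)
    ultimately have "(norm (s - 1))\<^sup>2 < 1\<^sup>2" by simp
    then show ?thesis unfolding w_def s_def[symmetric] by (rule power2_less_imp_less) simp
  qed
  have holm: "m holomorphic_on ball 0 1"
    unfolding m_def by (intro holomorphic_intros) (use nz in auto)
  \<comment> \<open>Positive real part keeps \<open>m\<close> off the branch cut of
    \<open>csqrt\<close>.\<close>
  have holw: "w holomorphic_on ball 0 1"
    unfolding w_def using Re_pos
    by (intro holomorphic_intros holm) (auto simp: complex_nonpos_Reals_iff not_le)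
  have eq: "zfprime_over_f ?F z = 1 + w z + (w z)\<^sup>2 / 2" if "norm z < 1" for z
  proof -
    have *: "1 + w z + (w z)\<^sup>2 / 2 = (1 + m z) / 2"
    proof -
      have "(1 + w z)\<^sup>2 = m z" by (simp add: w_def)
      then show ?thesis by (simp add: power2_eq_square algebra_simps)
    qed
    show ?thesis
    proof (cases "z = 0")
      case True
      then show ?thesis unfolding * by (simp add: zfprime_over_f_def m_def)
    next
      case False
      have "z + b * z\<^sup>2 = z * (1 + b * z)" by (simp add: power2_eq_square algebra_simps)
      then show ?thesis
        using False nz[OF that]
        unfolding * zfprime_over_f_def derF by (simp add: m_def) (simp add: field_simps)
    qed
  qed
  show ?thesis
    unfolding class_S_star_car_def class_A_def subordinate_def
  proof (intro conjI exI[of _ w] ballI)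
    show "?F holomorphic_on ball 0 1" by (intro holomorphic_intros)
    show "deriv ?F 0 = 1" by (simp add: derF)
    show "w 0 = 0" by (simp add: w_def m_def)
  qed (use holw w_lt eq in auto)
qed

section \<open>Dilated second partial sums\<close>

theorem theorem3p5:
  fixes f :: "complex \<Rightarrow> complex"
  assumes "class_A f"
  shows "(class_K f \<longrightarrow>
            (\<forall>\<rho>::real. 0 < \<rho> \<and> \<rho> \<le> 1/3 \<longrightarrow>
               class_S_star_car (\<lambda>z. partial2 f (of_real \<rho> * z) / of_real \<rho>)))
       \<and> ((class_S f \<or> class_S_star f \<or> class_C f) \<longrightarrow>
            (\<forall>\<rho>::real. 0 < \<rho> \<and> \<rho> \<le> 1/6 \<longrightarrow>
               class_S_star_car (\<lambda>z. partial2 f (of_real \<rho> * z) / of_real \<rho>)))"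
proof -
  \<comment> \<open>The dilation has quadratic coefficient f''(0) \<rho> / 2, so M \<rho> \<le> 2/3
    is the condition for the bound 1/3. The values 2 and 4 of \<open>M\<close> yield the radii 1/3
    and 1/6.\<close>
  have main: "class_S_star_car (\<lambda>z. partial2 f (of_real \<rho> * z) / of_real \<rho>)"
    if bound: "norm (deriv (deriv f) 0) \<le> M" and \<rho>: "0 < \<rho>" "M * \<rho> \<le> 2 / 3" for \<rho> M :: real
  proof -
    have "(\<lambda>z. partial2 f (of_real \<rho> * z) / of_real \<rho>) = (\<lambda>z. z + (deriv (deriv f) 0 / 2 * of_real \<rho>) * z\<^sup>2)"
      using \<rho> by (auto simp: partial2_def field_simps power2_eq_square)
    moreover have "norm (deriv (deriv f) 0) * \<rho> \<le> 2 / 3"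
      using order_trans[OF mult_right_mono[OF bound] \<rho>(2)] \<rho>(1) by simp
    then have "norm (deriv (deriv f) 0 / 2 * of_real \<rho>) \<le> 1 / 3"
      using \<rho> by (simp add: norm_mult norm_divide)
    ultimately show ?thesis using quadratic_in_S_star_car by metis
  qed
  have "norm (deriv (deriv f) 0) \<le> 2" if "class_K f"
    using that convex_second_coeff_bound[of f] by (simp add: class_K_def class_S_def class_A_def)
  moreover have "norm (deriv (deriv f) 0) \<le> 4" if "class_S f \<or> class_S_star f \<or> class_C f"
    using that Bieberbach_second_coeff_bound close_to_convex_second_coeff_bound
    by (auto simp: class_S_star_def)
  ultimately show ?thesis using main[of 2] main[of 4] by auto
qed

end
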